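(* Let $X=\prod_{i=1}^n\{0,\dots,m_i\}$ with integers $m_i\ge 1$, and let $f\colon X\to X$. If $f$ admits a mirror pair, then there exist two distinct states $x,y\in X$ such that both local interaction graphs $G_f(x)$ and $G_f(y)$ contain a cycle.
   Context: For $x,y\in X$ let $I(x,y)=\{i\mid x_i\ne y_i\}$. A pair of distinct states $x,y\in X$ is a mirror pair for $f$ if for every $i\in I(x,y)$ either $f_i(x)\le x_i,y_i\le f_i(y)$ or $f_i(y)\le x_i,y_i\le f_i(x)$. $e^j$ is the $j$-th unit vector and $\mathrm{sign}(0)=0$. The local interaction graph $G_f(x)$ at $x\in X$ is the labelled directed graph on $\{1,\dots,n\}$ with an edge from $j$ to $i$ of sign $s=s_1\,\mathrm{sign}(f_i(x+s_1e^j)-f_i(x))$ whenever $s_1\in\{-1,1\}$, $x+s_1e^j\in X$ and $s\ne0$. Cycles are elementary directed cycles (loops allowed). *)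

theory Defs
  imports "HOL-Library.FuncSet" "Graph_Theory.Arc_Walk"
begin

type_synonym state = "nat \<Rightarrow> int"

text \<open>States are extensional functions on \<open>{1..n}\<close> (constantly \<open>undefined\<close> elsewhere), so that
  equality of states is equality of all \<open>n\<close> components.\<close>

definition states :: "nat \<Rightarrow> (nat \<Rightarrow> int) \<Rightarrow> state set" where
  "states n m = (\<Pi>\<^sub>E i\<in>{1..n}. {0..m i})"

definition diff_set :: "nat \<Rightarrow> state \<Rightarrow> state \<Rightarrow> nat set" where
  "diff_set n x y = {i \<in> {1..n}. x i \<noteq> y i}"

definition mirror_pair ::
    "nat \<Rightarrow> (nat \<Rightarrow> int) \<Rightarrow> (state \<Rightarrow> state) \<Rightarrow> state \<Rightarrow> state \<Rightarrow> bool" where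
  "mirror_pair n m f x y \<longleftrightarrow>
     x \<in> states n m \<and> y \<in> states n m \<and> x \<noteq> y \<and>
     (\<forall>i\<in>diff_set n x y.
        (f x i \<le> x i \<and> f x i \<le> y i \<and> x i \<le> f y i \<and> y i \<le> f y i) \<or>
        (f y i \<le> x i \<and> f y i \<le> y i \<and> x i \<le> f x i \<and> y i \<le> f x i))"

text \<open>The state \<open>x + s \<cdot> e\<^sup>j\<close>.\<close>

definition shift :: "state \<Rightarrow> nat \<Rightarrow> int \<Rightarrow> state" where
  "shift x j s = x(j := x j + s)"

text \<open>An arc \<open>(j, s, i)\<close> goes from \<open>j\<close> to \<open>i\<close> and carries the sign \<open>s\<close>; a positive and a negative
  arc may both be present between the same two vertices.\<close>

definition local_interaction_graph ::
    "nat \<Rightarrow> (nat \<Rightarrow> int) \<Rightarrow> (state \<Rightarrow> state) \<Rightarrow> state \<Rightarrow> (nat, nat \<times> int \<times> nat) pre_digraph" where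
  "local_interaction_graph n m f x =
     \<lparr> verts = {1..n},
       arcs = {(j, s, i). j \<in> {1..n} \<and> i \<in> {1..n} \<and> s \<noteq> 0 \<and>
                 (\<exists>s1\<in>{-1, 1}. shift x j s1 \<in> states n m \<and>
                    s = s1 * sgn (f (shift x j s1) i - f x i))},
       tail = (\<lambda>(j, s, i). j),
       head = (\<lambda>(j, s, i). i) \<rparr>"

end

theory Submission
  imports Defs
begin

text \<open>Take a mirror pair \<open>(x, y)\<close> at minimal \<open>L\<^sup>1\<close> distance and let \<open>I\<close> be the set of
  coordinates in which \<open>x\<close> and \<open>y\<close> differ. Suppose that some \<open>j \<in> I\<close> has no arc of \<open>G\<^sub>f(x)\<close> into
  \<open>I\<close>, and let \<open>x'\<close> be obtained from \<open>x\<close> by moving one step towards \<open>y\<close> in coordinate \<open>j\<close>. Then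
  \<open>f(x')\<close> and \<open>f(x)\<close> agree on \<open>I\<close>, which excludes \<open>x' = y\<close> and makes \<open>(x', y)\<close> a closer mirror
  pair. Hence in \<open>G\<^sub>f(x)\<close> every vertex of the finite nonempty set \<open>I\<close> has an arc into \<open>I\<close>, so there
  is a cycle; by symmetry the same holds for \<open>G\<^sub>f(y)\<close>.\<close>

lemma (in wf_digraph) cycle_if_out_arcs_within:
  assumes "finite I" and "I \<noteq> {}"
    and out: "\<And>u. u \<in> I \<Longrightarrow> \<exists>v\<in>I. (u, v) \<in> arcs_ends G"
  shows "\<exists>p. cycle p"
proof -
  define R where "R = arcs_ends G \<inter> I \<times> I"
  have "finite R" using \<open>finite I\<close> by (simp add: R_def)
  have "\<not> acyclic R"
  proof
    assume "acyclic R"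
    \<comment> \<open>A minimal element of \<open>I\<close> for the converse of \<open>R\<close> is
      a vertex without successor in \<open>I\<close>, which \<open>out\<close> forbids.\<close>
    then have "wf (R\<inverse>)"
      using \<open>finite R\<close> by (rule finite_acyclic_wf_converse[rotated])
    then obtain z where "z \<in> I" and "\<And>v. (z, v) \<in> R \<Longrightarrow> v \<notin> I"
      using wfE_min'[of "R\<inverse>" I] \<open>I \<noteq> {}\<close> by auto
    then show False using out[of z] unfolding R_def by blast
  qed
  then obtain u where "(u, u) \<in> R\<^sup>+" by (auto simp: acyclic_def)
  then have "(u, u) \<in> (arcs_ends G)\<^sup>+" by (rule trancl_mono) (auto simp: R_def)
  then obtain p where "awalk u p u" "p \<noteq> []" using reachable1_awalk by blast
  then show ?thesis using closed_w_imp_cycle by (auto simp: closed_w_def)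
qed

lemma wf_digraph_local_interaction_graph: "wf_digraph (local_interaction_graph n m f x)"
  by unfold_locales (auto simp: local_interaction_graph_def)

lemma local_interaction_graph_arcs_endsI:
  assumes "j \<in> {1..n}" "i \<in> {1..n}" "s \<in> {-1, 1}" "shift x j s \<in> states n m"
    and "f (shift x j s) i \<noteq> f x i"
  shows "(j, i) \<in> arcs_ends (local_interaction_graph n m f x)"
proof -
  have "(j, s * sgn (f (shift x j s) i - f x i), i) \<in> arcs (local_interaction_graph n m f x)"
    using assms by (auto simp: local_interaction_graph_def sgn_0_0)
  then show ?thesis
    unfolding arcs_ends_def
    by (rule rev_image_eqI) (simp add: arc_to_ends_def local_interaction_graph_def)
qed

lemma mirror_pair_commute: "mirror_pair n m f x y \<longleftrightarrow> mirror_pair n m f y x"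
proof -
  have "diff_set n x y = diff_set n y x" by (auto simp: diff_set_def)
  then show ?thesis unfolding mirror_pair_def by auto
qed

text \<open>Truncating to \<open>nat\<close> loses nothing on absolute values and lets a closest
  mirror pair be chosen by well-ordering.\<close>

definition l1_dist :: "nat \<Rightarrow> state \<Rightarrow> state \<Rightarrow> nat" where
  "l1_dist n x y = (\<Sum>i\<in>{1..n}. nat \<bar>x i - y i\<bar>)"

lemma l1_dist_commute: "l1_dist n x y = l1_dist n y x"
  by (simp add: l1_dist_def abs_minus_commute)

text \<open>The sign of \<open>y j - x j\<close> points from \<open>x\<close> towards
  \<open>y\<close>, so the summand at \<open>j\<close> drops by one and the others stay.\<close>

lemma l1_dist_shift_less:
  assumes "j \<in> diff_set n x y"
  shows "l1_dist n (shift x j (sgn (y j - x j))) y < l1_dist n x y"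
  unfolding l1_dist_def
proof (rule sum_strict_mono_ex1)
  show "\<exists>i\<in>{1..n}. nat \<bar>shift x j (sgn (y j - x j)) i - y i\<bar> < nat \<bar>x i - y i\<bar>"
    using assms by (intro bexI[of _ j]) (auto simp: diff_set_def shift_def sgn_if)
qed (use assms in \<open>auto simp: diff_set_def shift_def sgn_if\<close>)

lemma shift_in_states:
  assumes "x \<in> states n m" "y \<in> states n m" "j \<in> diff_set n x y"
  shows "shift x j (sgn (y j - x j)) \<in> states n m"
proof -
  have j: "j \<in> {1..n}" and "x j \<noteq> y j" using assms(3) by (auto simp: diff_set_def)
  moreover have "x j \<in> {0..m j}" "y j \<in> {0..m j}"
    using assms j by (auto simp: states_def)
  ultimately have "x j + sgn (y j - x j) \<in> {0..m j}" by (auto simp: sgn_if)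
  \<comment> \<open>Updating at \<open>j\<close> puts the state in the product over
    \<open>insert j {1..n}\<close>, which is \<open>{1..n}\<close> again.\<close>
  then have "x(j := x j + sgn (y j - x j)) \<in> (\<Pi>\<^sub>E i\<in>insert j {1..n}. {0..m i})"
    using assms(1) unfolding states_def by (intro PiE_fun_upd)
  then show ?thesis using j by (simp add: states_def shift_def insert_absorb)
qed

lemma mirror_pair_shift:
  assumes "mirror_pair n m f x y" and j: "j \<in> diff_set n x y"
    and eq: "\<And>i. i \<in> diff_set n x y \<Longrightarrow> f (shift x j (sgn (y j - x j))) i = f x i"
  shows "mirror_pair n m f (shift x j (sgn (y j - x j))) y"
proof -
  define z where "z = shift x j (sgn (y j - x j))"
  have states: "x \<in> states n m" "y \<in> states n m"
    and cond: "\<And>i. i \<in> diff_set n x y \<Longrightarrow>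
        (f x i \<le> x i \<and> f x i \<le> y i \<and> x i \<le> f y i \<and> y i \<le> f y i) \<or>
        (f y i \<le> x i \<and> f y i \<le> y i \<and> x i \<le> f x i \<and> y i \<le> f x i)"
    using assms(1) by (auto simp: mirror_pair_def)
  have xj: "x j \<noteq> y j" using j by (simp add: diff_set_def)
  have "z \<in> states n m" unfolding z_def using states j by (rule shift_in_states)
  moreover have "z \<noteq> y"
  proof
    assume "z = y"
    \<comment> \<open>The mirror condition squeezes \<open>x j\<close> and \<open>y j\<close>
      between \<open>f x j\<close> and \<open>f y j\<close>; if these two coincide, so do
      \<open>x j\<close> and \<open>y j\<close>.\<close>
    then have "f y j = f x j" using eq[OF j] by (simp add: z_def)
    then show False using cond[OF j] xj by linarith
  qed
  moreover have "(f z i \<le> z i \<and> f z i \<le> y i \<and> z i \<le> f y i \<and> y i \<le> f y i) \<or>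
      (f y i \<le> z i \<and> f y i \<le> y i \<and> z i \<le> f z i \<and> y i \<le> f z i)"
    if "i \<in> diff_set n z y" for i
  proof -
    have i: "i \<in> diff_set n x y"
      using that j by (auto simp: z_def shift_def diff_set_def split: if_splits)
    have "f z i = f x i" using eq[OF i] by (simp add: z_def)
    \<comment> \<open>The interval spanned by \<open>x i\<close> and \<open>y i\<close> lies between
      \<open>f x i\<close> and \<open>f y i\<close>, hence so does any \<open>z i\<close> inside
      it.\<close>
    moreover have "min (x i) (y i) \<le> z i" "z i \<le> max (x i) (y i)"
      using xj by (auto simp: z_def shift_def sgn_if)
    ultimately show ?thesis using cond[OF i] by linarith
  qed
  ultimately show ?thesis using states by (simp add: mirror_pair_def z_def)
qed

text \<open>Only the first state is moved, so minimality is stated among pairs with the same second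
  state.\<close>

lemma cycle_if_mirror_pair_minimal:
  assumes xy: "mirror_pair n m f x y"
    and min: "\<And>z. mirror_pair n m f z y \<Longrightarrow> l1_dist n x y \<le> l1_dist n z y"
  shows "\<exists>p. pre_digraph.cycle (local_interaction_graph n m f x) p"
proof -
  have states: "x \<in> states n m" "y \<in> states n m" and "x \<noteq> y"
    using xy by (auto simp: mirror_pair_def)
  interpret wf_digraph "local_interaction_graph n m f x"
    by (rule wf_digraph_local_interaction_graph)
  show ?thesis
  proof (rule cycle_if_out_arcs_within)
    show "finite (diff_set n x y)" by (simp add: diff_set_def)
    show "diff_set n x y \<noteq> {}"
    proof
      assume "diff_set n x y = {}"
      then have "x i = y i" if "i \<in> {1..n}" for i using that by (auto simp: diff_set_def)
      with states \<open>x \<noteq> y\<close> show False unfolding states_def by (meson PiE_ext)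
    qed
    fix j assume j: "j \<in> diff_set n x y"
    define s where "s = sgn (y j - x j)"
    have "\<not> mirror_pair n m f (shift x j s) y"
      using min l1_dist_shift_less[OF j] unfolding s_def by (meson not_le)
    then obtain i where i: "i \<in> diff_set n x y" "f (shift x j s) i \<noteq> f x i"
      using mirror_pair_shift[OF xy j] unfolding s_def by blast
    have "(j, i) \<in> arcs_ends (local_interaction_graph n m f x)"
    proof (rule local_interaction_graph_arcs_endsI)
      show "s \<in> {-1, 1}" using j by (auto simp: s_def sgn_if diff_set_def)
      show "shift x j s \<in> states n m" unfolding s_def using states j by (rule shift_in_states)
    qed (use i j in \<open>auto simp: diff_set_def\<close>)
    with i show "\<exists>i\<in>diff_set n x y. (j, i) \<in> arcs_ends (local_interaction_graph n m f x)"
      by blast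
  qed
qed

theorem theorem4:
  fixes n :: nat and m :: "nat \<Rightarrow> int" and f :: "state \<Rightarrow> state"
  assumes "\<And>i. i \<in> {1..n} \<Longrightarrow> m i \<ge> 1"
    and "f \<in> states n m \<rightarrow> states n m"
    and "\<exists>a b. mirror_pair n m f a b"
  shows "\<exists>x y. x \<in> states n m \<and> y \<in> states n m \<and> x \<noteq> y \<and>
           (\<exists>p. pre_digraph.cycle (local_interaction_graph n m f x) p) \<and>
           (\<exists>q. pre_digraph.cycle (local_interaction_graph n m f y) q)"
proof -
  obtain a b where "mirror_pair n m f a b" using assms(3) by blast
  then obtain x y where xy: "mirror_pair n m f x y"
    and min: "\<And>u v. mirror_pair n m f u v \<Longrightarrow> l1_dist n x y \<le> l1_dist n u v"
    using ex_has_least_nat[of "\<lambda>(u, v). mirror_pair n m f u v" "(a, b)" "\<lambda>(u, v). l1_dist n u v"]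
    by auto
  have "\<exists>p. pre_digraph.cycle (local_interaction_graph n m f x) p"
    using xy min by (rule cycle_if_mirror_pair_minimal)
  \<comment> \<open>Being a mirror pair and the distance are both symmetric, so the swapped pair is
    minimal too.\<close>
  moreover have "\<exists>q. pre_digraph.cycle (local_interaction_graph n m f y) q"
    by (rule cycle_if_mirror_pair_minimal[where y = x])
      (use xy min in \<open>simp_all add: mirror_pair_commute[of _ _ _ y] l1_dist_commute[of _ y]\<close>)
  ultimately show ?thesis using xy unfolding mirror_pair_def by blast
qed

end
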